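(* Let $X$ be a Banach space, $E\subset X$ a nonempty closed convex subset, and $T:E\to E$ a contractive-like mapping, i.e. there exist a constant $\delta\in[0,1)$ and a strictly increasing continuous function $\varphi:[0,\infty)\to[0,\infty)$ with $\varphi(0)=0$ such that $$\|Tx-Ty\|\le \delta\|x-y\|+\varphi(\|x-Tx\|)\qquad\text{for all }x,y\in E.$$ Suppose the set of fixed points $F_T=\{p: p=Tp\}$ is nonempty and let $p\in F_T$. Let $\{\alpha_n\}_{n\ge0}$ and $\{\beta_n\}_{n\ge0}$ be real sequences in $[0,1)$, and assume that there is a constant $A$ with $\alpha_n\ge A>0$ for all $n\in\mathbb{N}$. Let $\{u_n\}_{n\ge0}$ be the Mann iteration with parameters $\{\alpha_n\}$ and let $\{x_n\}_{n\ge0}$ be the S-iteration with parameters $\{\alpha_n\}$, $\{\beta_n\}$, with the same initial point $x_0=u_0\in E$. Then the following are equivalent: (1) the Mann iteration $\{u_n\}$ converges to $p$; (2) the S-iteration $\{x_n\}$ converges to $p$.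
   Context: $\mathbb{N}$ denotes the set of all nonnegative integers. Convergence is in the norm of $X$. The Mann iteration is defined by $u_0\in E$ and $u_{n+1}=(1-\alpha_n)u_n+\alpha_nTu_n$, $n\in\mathbb{N}$. The S-iteration is defined by $x_0\in E$ and, for $n\in\mathbb{N}$, $$x_{n+1}=(1-\alpha_n)Tx_n+\alpha_nTy_n,\qquad y_n=(1-\beta_n)x_n+\beta_nTx_n.$$ *)

theory Defs
  imports "HOL-Analysis.Analysis"
begin

definition contractive_like_on ::
    "'a::real_normed_vector set \<Rightarrow> ('a \<Rightarrow> 'a) \<Rightarrow> bool"
  where "contractive_like_on E T \<longleftrightarrow>
    (\<exists>(\<delta>::real) (\<phi>::real \<Rightarrow> real).
       0 \<le> \<delta> \<and> \<delta> < 1 \<and>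
       \<phi> \<in> {0..} \<rightarrow> {0..} \<and> strict_mono_on {0..} \<phi> \<and> continuous_on {0..} \<phi> \<and> \<phi> 0 = 0 \<and>
       (\<forall>x\<in>E. \<forall>y\<in>E. norm (T x - T y) \<le> \<delta> * norm (x - y) + \<phi> (norm (x - T x))))"

definition fixed_points_on :: "'a set \<Rightarrow> ('a \<Rightarrow> 'a) \<Rightarrow> 'a set"
  where "fixed_points_on E T = {p \<in> E. p = T p}"

primrec mann_iteration ::
    "('a::real_vector \<Rightarrow> 'a) \<Rightarrow> (nat \<Rightarrow> real) \<Rightarrow> 'a \<Rightarrow> nat \<Rightarrow> 'a"
  where
    "mann_iteration T \<alpha> u0 0 = u0"
  | "mann_iteration T \<alpha> u0 (Suc n) =
       (1 - \<alpha> n) *\<^sub>R mann_iteration T \<alpha> u0 n + \<alpha> n *\<^sub>R T (mann_iteration T \<alpha> u0 n)"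

primrec S_iteration ::
    "('a::real_vector \<Rightarrow> 'a) \<Rightarrow> (nat \<Rightarrow> real) \<Rightarrow> (nat \<Rightarrow> real) \<Rightarrow> 'a \<Rightarrow> nat \<Rightarrow> 'a"
  where
    "S_iteration T \<alpha> \<beta> x0 0 = x0"
  | "S_iteration T \<alpha> \<beta> x0 (Suc n) =
       (let x = S_iteration T \<alpha> \<beta> x0 n;
            y = (1 - \<beta> n) *\<^sub>R x + \<beta> n *\<^sub>R T x
        in (1 - \<alpha> n) *\<^sub>R T x + \<alpha> n *\<^sub>R T y)"

end

theory Submission
  imports Defs
begin

text \<open>
  The equivalence holds because both iterations converge to \<open>p\<close> unconditionally. Putting \<open>x = p\<close>
  in the contractive-like inequality makes the term \<open>\<phi> (norm (x - T x))\<close> vanish, so \<open>T\<close> moves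
  every point of \<open>E\<close> closer to \<open>p\<close> by the factor \<open>\<delta> < 1\<close>
  (\<open>contractive_like_on_dist_fixed_point\<close>). Taking convex combinations, one Mann step multiplies
  the distance to \<open>p\<close> by at most \<open>1 - \<alpha> n * (1 - \<delta>) \<le> 1 - A * (1 - \<delta>) < 1\<close>, and one S-step by
  at most \<open>\<delta>\<close>, since it averages two values of \<open>T\<close> at points no farther from \<open>p\<close>
  than the current iterate. The distances to \<open>p\<close> therefore decay geometrically.
\<close>

lemma contractive_like_on_dist_fixed_point:
  fixes T :: "'a::real_normed_vector \<Rightarrow> 'a"
  assumes "contractive_like_on E T" and "p \<in> fixed_points_on E T"
  obtains \<delta> where "0 \<le> \<delta>" and "\<delta> < 1"
    and "\<And>y. y \<in> E \<Longrightarrow> norm (T y - p) \<le> \<delta> * norm (y - p)"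
proof -
  obtain \<delta> :: real and \<phi> :: "real \<Rightarrow> real" where
    \<delta>: "0 \<le> \<delta>" "\<delta> < 1" and "\<phi> 0 = 0" and
    T: "\<And>x y. x \<in> E \<Longrightarrow> y \<in> E \<Longrightarrow> norm (T x - T y) \<le> \<delta> * norm (x - y) + \<phi> (norm (x - T x))"
    using assms(1) unfolding contractive_like_on_def by blast
  have p: "p \<in> E" "T p = p"
    using assms(2) by (auto simp: fixed_points_on_def)
  have "norm (T y - p) \<le> \<delta> * norm (y - p)" if "y \<in> E" for y
    using T[OF p(1) that] p(2) \<open>\<phi> 0 = 0\<close> by (simp add: norm_minus_commute)
  with \<delta> that show thesis by blast
qed

lemma norm_convex_combination_diff_le:
  fixes x y p :: "'a::real_normed_vector"
  assumes "0 \<le> a" and "a \<le> 1"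
  shows "norm ((1 - a) *\<^sub>R x + a *\<^sub>R y - p) \<le> (1 - a) * norm (x - p) + a * norm (y - p)"
proof -
  have "(1 - a) *\<^sub>R x + a *\<^sub>R y - p = (1 - a) *\<^sub>R (x - p) + a *\<^sub>R (y - p)"
    by (simp add: algebra_simps)
  then show ?thesis
    using assms norm_triangle_ineq[of "(1 - a) *\<^sub>R (x - p)" "a *\<^sub>R (y - p)"] by simp
qed

lemma LIMSEQ_if_norm_diff_geometric:
  fixes f :: "nat \<Rightarrow> 'a::real_normed_vector"
  assumes "0 \<le> q" and "q < 1"
    and step: "\<And>n. norm (f (Suc n) - p) \<le> q * norm (f n - p)"
  shows "f \<longlonglongrightarrow> p"
proof -
  have bound: "norm (f n - p) \<le> q ^ n * norm (f 0 - p)" for n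
  proof (induction n)
    case (Suc n)
    have "norm (f (Suc n) - p) \<le> q * norm (f n - p)" by (rule step)
    also have "\<dots> \<le> q * (q ^ n * norm (f 0 - p))"
      using Suc.IH \<open>0 \<le> q\<close> by (rule mult_left_mono)
    finally show ?case by (simp add: mult.assoc)
  qed simp
  have "(\<lambda>n. q ^ n * norm (f 0 - p)) \<longlonglongrightarrow> 0"
    using assms by (intro tendsto_mult_left_zero LIMSEQ_realpow_zero)
  then have "(\<lambda>n. f n - p) \<longlonglongrightarrow> 0"
    by (rule Lim_null_comparison[rotated]) (simp add: bound)
  then show ?thesis by (rule LIM_zero_cancel)
qed

lemma mann_iteration_in:
  assumes "convex E" and "T \<in> E \<rightarrow> E" and "\<And>n. \<alpha> n \<in> {0..<1}" and "u0 \<in> E"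
  shows "mann_iteration T \<alpha> u0 n \<in> E"
proof (induction n)
  case (Suc n)
  with assms(2) have "T (mann_iteration T \<alpha> u0 n) \<in> E" by blast
  with Suc.IH assms(1) assms(3)[of n] show ?case
    by (simp add: convexD)
qed (simp add: assms)

lemma S_iteration_in:
  assumes "convex E" and "T \<in> E \<rightarrow> E" and "\<And>n. \<alpha> n \<in> {0..<1}" and "\<And>n. \<beta> n \<in> {0..<1}"
    and "x0 \<in> E"
  shows "S_iteration T \<alpha> \<beta> x0 n \<in> E"
proof (induction n)
  case (Suc n)
  define x where "x = S_iteration T \<alpha> \<beta> x0 n"
  define y where "y = (1 - \<beta> n) *\<^sub>R x + \<beta> n *\<^sub>R T x"
  have "x \<in> E" "T x \<in> E" using Suc.IH assms(2) by (auto simp: x_def)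
  then have "y \<in> E" using assms(1) assms(4)[of n] by (simp add: y_def convexD)
  then have "T y \<in> E" using assms(2) by blast
  with \<open>T x \<in> E\<close> have "(1 - \<alpha> n) *\<^sub>R T x + \<alpha> n *\<^sub>R T y \<in> E"
    using assms(1) assms(3)[of n] by (simp add: convexD)
  then show ?case by (simp add: x_def y_def Let_def)
qed (simp add: assms)

text \<open>
  The lower bound \<open>A\<close> makes the contraction factors uniform in \<open>n\<close>. Without it a Mann step could
  leave the iterate almost fixed and the errors need not tend to \<open>0\<close>.
\<close>

lemma mann_iteration_tendsto_fixed_point:
  fixes T :: "'a::real_normed_vector \<Rightarrow> 'a"
  assumes "convex E" and "T \<in> E \<rightarrow> E"
    and "contractive_like_on E T" and "p \<in> fixed_points_on E T"
    and \<alpha>: "\<And>n. \<alpha> n \<in> {0..<1}" and "A > 0" and A: "\<And>n. \<alpha> n \<ge> A" and "u0 \<in> E"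
  shows "mann_iteration T \<alpha> u0 \<longlonglongrightarrow> p"
proof -
  obtain \<delta> where \<delta>: "0 \<le> \<delta>" "\<delta> < 1"
    and T: "\<And>y. y \<in> E \<Longrightarrow> norm (T y - p) \<le> \<delta> * norm (y - p)"
    using contractive_like_on_dist_fixed_point assms(3,4) by blast
  show ?thesis
  proof (rule LIMSEQ_if_norm_diff_geometric)
    have "A < 1" using A[of 0] \<alpha>[of 0] by simp
    with \<delta> \<open>A > 0\<close> have "A * (1 - \<delta>) \<le> 1" by (intro mult_le_one) auto
    then show "0 \<le> 1 - A * (1 - \<delta>)" by simp
    show "1 - A * (1 - \<delta>) < 1" using \<delta> \<open>A > 0\<close> by simp
  next
    fix n
    define u where "u = mann_iteration T \<alpha> u0 n"
    have "u \<in> E" unfolding u_def using assms by (intro mann_iteration_in)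
    have "norm (mann_iteration T \<alpha> u0 (Suc n) - p)
        \<le> (1 - \<alpha> n) * norm (u - p) + \<alpha> n * norm (T u - p)"
      using norm_convex_combination_diff_le[of "\<alpha> n" u "T u" p] \<alpha>[of n] by (simp add: u_def)
    also have "\<dots> \<le> (1 - \<alpha> n) * norm (u - p) + \<alpha> n * (\<delta> * norm (u - p))"
      using T[OF \<open>u \<in> E\<close>] \<alpha>[of n] by (intro add_left_mono mult_left_mono) auto
    also have "\<dots> = (1 - \<alpha> n * (1 - \<delta>)) * norm (u - p)" by (simp add: algebra_simps)
    also have "\<dots> \<le> (1 - A * (1 - \<delta>)) * norm (u - p)"
      using A[of n] \<delta> by (intro mult_right_mono diff_left_mono) auto
    finally show "norm (mann_iteration T \<alpha> u0 (Suc n) - p)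
        \<le> (1 - A * (1 - \<delta>)) * norm (mann_iteration T \<alpha> u0 n - p)"
      by (simp only: u_def)
  qed
qed

text \<open>
  The inner point \<open>y\<close> is no farther from \<open>p\<close> than \<open>x\<close>, so \<open>T x\<close> and \<open>T y\<close> both lie in the ball
  of radius \<open>\<delta> * norm (x - p)\<close> around \<open>p\<close>, and so does every convex combination of them. The rate
  \<open>\<delta>\<close> is thus the same for all parameter sequences.
\<close>

lemma S_iteration_tendsto_fixed_point:
  fixes T :: "'a::real_normed_vector \<Rightarrow> 'a"
  assumes "convex E" and "T \<in> E \<rightarrow> E"
    and "contractive_like_on E T" and "p \<in> fixed_points_on E T"
    and \<alpha>: "\<And>n. \<alpha> n \<in> {0..<1}" and \<beta>: "\<And>n. \<beta> n \<in> {0..<1}" and "x0 \<in> E"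
  shows "S_iteration T \<alpha> \<beta> x0 \<longlonglongrightarrow> p"
proof -
  obtain \<delta> where \<delta>: "0 \<le> \<delta>" "\<delta> < 1"
    and T: "\<And>y. y \<in> E \<Longrightarrow> norm (T y - p) \<le> \<delta> * norm (y - p)"
    using contractive_like_on_dist_fixed_point assms(3,4) by blast
  show ?thesis
  proof (rule LIMSEQ_if_norm_diff_geometric)
    show "0 \<le> \<delta>" "\<delta> < 1" by (fact \<delta>)+
  next
    fix n
    define x where "x = S_iteration T \<alpha> \<beta> x0 n"
    define y where "y = (1 - \<beta> n) *\<^sub>R x + \<beta> n *\<^sub>R T x"
    have "x \<in> E" unfolding x_def using assms by (intro S_iteration_in)
    then have "T x \<in> E" using assms(2) by blast
    with \<open>x \<in> E\<close> have "y \<in> E" using \<open>convex E\<close> \<beta>[of n] by (simp add: y_def convexD)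
    have Tx: "norm (T x - p) \<le> \<delta> * norm (x - p)" using T \<open>x \<in> E\<close> .
    also have "\<dots> \<le> norm (x - p)" using \<delta> by (simp add: mult_left_le_one_le)
    finally have "\<beta> n * norm (T x - p) \<le> \<beta> n * norm (x - p)"
      using \<beta>[of n] by (intro mult_left_mono) auto
    then have "norm (y - p) \<le> norm (x - p)"
      using norm_convex_combination_diff_le[of "\<beta> n" x "T x" p] \<beta>[of n]
      by (simp add: y_def algebra_simps)
    then have Ty: "norm (T y - p) \<le> \<delta> * norm (x - p)"
      using T[OF \<open>y \<in> E\<close>] \<delta> by (meson mult_left_mono order_trans)
    have "norm (S_iteration T \<alpha> \<beta> x0 (Suc n) - p)
        \<le> (1 - \<alpha> n) * norm (T x - p) + \<alpha> n * norm (T y - p)"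
      using norm_convex_combination_diff_le[of "\<alpha> n" "T x" "T y" p] \<alpha>[of n]
      by (simp add: x_def y_def Let_def)
    also have "\<dots> \<le> \<delta> * norm (x - p)"
      using Tx Ty \<alpha>[of n] by (intro convex_bound_le) auto
    finally show "norm (S_iteration T \<alpha> \<beta> x0 (Suc n) - p)
        \<le> \<delta> * norm (S_iteration T \<alpha> \<beta> x0 n - p)"
      by (simp only: x_def)
  qed
qed

theorem theorem2:
  fixes E :: "'a::banach set"
    and T :: "'a \<Rightarrow> 'a"
    and p x0 :: 'a
    and \<alpha> \<beta> :: "nat \<Rightarrow> real"
    and A :: real
  assumes "E \<noteq> {}" and "closed E" and "convex E"
    and "T \<in> E \<rightarrow> E"
    and "contractive_like_on E T"
    and "fixed_points_on E T \<noteq> {}"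
    and "p \<in> fixed_points_on E T"
    and "\<And>n. \<alpha> n \<in> {0..<1}"
    and "\<And>n. \<beta> n \<in> {0..<1}"
    and "A > 0" and "\<And>n. \<alpha> n \<ge> A"
    and "x0 \<in> E"
  shows "(mann_iteration T \<alpha> x0 \<longlonglongrightarrow> p) \<longleftrightarrow> (S_iteration T \<alpha> \<beta> x0 \<longlonglongrightarrow> p)"
proof -
  have "mann_iteration T \<alpha> x0 \<longlonglongrightarrow> p"
    using assms by (intro mann_iteration_tendsto_fixed_point)
  moreover have "S_iteration T \<alpha> \<beta> x0 \<longlonglongrightarrow> p"
    using assms by (intro S_iteration_tendsto_fixed_point)
  ultimately show ?thesis by simp
qed

end
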